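(* Consider the polynomial decay change-point model. If the link function $\widetilde\Psi$ is continuous and $r>1$, then for any block $\Xi\in[K]^\ell$ and any $\epsilon>0$ there exists a positive integer $M(\Xi,\epsilon)$ such that for any $M\ge M(\Xi,\epsilon)$ $$\sup_{t\ge0,\,z\in[K]^t,\,j\in[\ell]}\Big|\frac1M\sum_{s=1}^M\omega\big(\pi_{t+s}(z,\Xi(j:s+j-1))\big)-d(\Xi)\Big|\le\epsilon,\qquad d(\Xi)=\frac1\ell\sum_{j=1}^\ell\omega\big(\widetilde\Psi(\chi_j)\big),$$ where $\omega(x)=|\log(1-x)|$ and $$\chi_j=\sum_{i=j-\ell+1}^jq_{\Xi(i)}\Big(\sum_{\iota=0}^\infty(j+1-i+\iota\ell)^{-r}\Big),\qquad1\le j\le\ell.$$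
   Context: Fix $K\ge2$, $[K]=\{1,\dots,K\}$. In the change-point model, $\pi_t(x_1,\dots,x_t)\in[0,1)$ is the conditional probability that the change occurs at time $t$, given that it has not occurred before and that treatments $x_1,\dots,x_t\in[K]$ have been assigned. Polynomial decay model: $\pi_t(x_1,\dots,x_t)=\widetilde\Psi\big(\sum_{s=1}^tq_{x_s}(t-s+1)^{-r}\big)$, $t\ge1$, where $\widetilde\Psi:[0,\infty]\to[0,1)$, $r>0$, $q_x\ge0$ for $x\in[K]$. A block $\Xi\in[K]^\ell$ is extended cyclically: $\Xi(m\ell+i)=\Xi(i)$ for every integer $m$, $1\le i\le\ell$; $\Xi(i:j)=(\Xi(i),\dots,\Xi(j))$. In $\pi_{t+s}(z,\Xi(j:s+j-1))$ the first $t$ treatments are $z$ and the next $s$ are $\Xi(j),\dots,\Xi(s+j-1)$. *)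

theory Defs
  imports "HOL-Library.Extended_Nonnegative_Real"
begin

definition treatments :: "nat \<Rightarrow> nat \<Rightarrow> nat list set" where
  "treatments K n = {xs. length xs = n \<and> set xs \<subseteq> {1..K}}"

(* pi_t(x_1, ..., x_t) in the polynomial decay model, with t = length xs and x_s = xs ! (s - 1).
   The link function is defined on [0, \<infinity>], represented by ennreal. *)
definition change_prob :: "(ennreal \<Rightarrow> real) \<Rightarrow> (nat \<Rightarrow> real) \<Rightarrow> real \<Rightarrow> nat list \<Rightarrow> real" where
  "change_prob \<Psi> q r xs =
     \<Psi> (ennreal (\<Sum>s=1..length xs. q (xs ! (s - 1)) * real (length xs - s + 1) powr (- r)))"

(* Blocks are 1-based and extended cyclically to all integer positions. *)
definition cyc :: "nat list \<Rightarrow> int \<Rightarrow> nat" where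
  "cyc \<Xi> i = \<Xi> ! nat ((i - 1) mod int (length \<Xi>))"

definition segment :: "nat list \<Rightarrow> int \<Rightarrow> int \<Rightarrow> nat list" where
  "segment \<Xi> i j = map (cyc \<Xi>) [i..j]"

definition omega :: "real \<Rightarrow> real" where
  "omega x = \<bar>ln (1 - x)\<bar>"

(* Valued in [0, \<infinity>], so that the inner series needs no convergence hypothesis. *)
definition chi :: "(nat \<Rightarrow> real) \<Rightarrow> real \<Rightarrow> nat list \<Rightarrow> int \<Rightarrow> ennreal" where
  "chi q r \<Xi> j =
     (\<Sum>i=j - int (length \<Xi>) + 1..j.
        ennreal (q (cyc \<Xi> i)) *
        (\<Sum>\<iota>. ennreal (real_of_int (j + 1 - i + int \<iota> * int (length \<Xi>)) powr (- r))))"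

definition block_rate :: "(ennreal \<Rightarrow> real) \<Rightarrow> (nat \<Rightarrow> real) \<Rightarrow> real \<Rightarrow> nat list \<Rightarrow> real" where
  "block_rate \<Psi> q r \<Xi> =
     1 / real (length \<Xi>) * (\<Sum>j=1..int (length \<Xi>). omega (\<Psi> (chi q r \<Xi> j)))"

end

(* The change probability after t + s treatments is the link function applied to a series in the
   lag k with weights (k + 1)^(-r). Its first s coefficients agree with those of the cyclic block
   extended infinitely into the past, so the two series differ by at most a multiple of the tail of
   a convergent series, uniformly in t, z and j. Since omega composed with the link function is
   uniformly continuous on a compact interval containing all these series, all but boundedly many
   summands are close to an l-periodic sequence, whose averages converge to its mean over a block. *)

theory Submission
  imports Defs "HOL-Analysis.Analysis"
begin

lemma cyc_mem: "\<Xi> \<noteq> [] \<Longrightarrow> cyc \<Xi> i \<in> set \<Xi>"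
  by (simp add: cyc_def nat_less_iff)

lemma cyc_add_length: "cyc \<Xi> (i + int (length \<Xi>)) = cyc \<Xi> i"
proof -
  have "(i + int (length \<Xi>) - 1) mod int (length \<Xi>) = (i - 1 + int (length \<Xi>)) mod int (length \<Xi>)"
    by (simp add: algebra_simps)
  then show ?thesis by (simp add: cyc_def)
qed

lemma length_segment: "length (segment \<Xi> j (int s + j - 1)) = s"
  by (simp add: segment_def)

lemma nth_append_segment_from_end:
  assumes "k < s"
  shows "(z @ segment \<Xi> j (int s + j - 1)) ! (length z + s - Suc k) = cyc \<Xi> (j + int s - 1 - int k)"
proof -
  have e: "length z + s - Suc k = length z + (s - Suc k)" using assms by simp
  have "(z @ segment \<Xi> j (int s + j - 1)) ! (length z + s - Suc k) = segment \<Xi> j (int s + j - 1) ! (s - Suc k)"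
    unfolding e by (rule nth_append_length_plus)
  also have "\<dots> = cyc \<Xi> (j + int (s - Suc k))"
    using assms by (simp add: segment_def)
  also have "j + int (s - Suc k) = j + int s - 1 - int k"
    using assms by (simp add: of_nat_diff)
  finally show ?thesis .
qed

text \<open>The real-valued \<open>\<chi>\<^sub>j\<close>, summed by the lag \<open>k = j - i + \<iota>\<ell>\<close>.\<close>

definition periodic_load :: "(nat \<Rightarrow> real) \<Rightarrow> real \<Rightarrow> nat list \<Rightarrow> int \<Rightarrow> real" where
  "periodic_load q r \<Xi> p = (\<Sum>k. q (cyc \<Xi> (p - int k)) * real (Suc k) powr (- r))"

lemma periodic_load_add_length:
  "periodic_load q r \<Xi> (p + int (length \<Xi>)) = periodic_load q r \<Xi> p"
proof -
  have "cyc \<Xi> (p + int (length \<Xi>) - int k) = cyc \<Xi> (p - int k)" for k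
    using cyc_add_length[of \<Xi> "p - int k"] by (simp add: algebra_simps)
  then show ?thesis by (simp add: periodic_load_def)
qed

lemma summable_Suc_powr:
  assumes "r > 1"
  shows "summable (\<lambda>k. real (Suc k) powr (- r))"
  using assms by (subst summable_Suc_iff[where f = "\<lambda>k. real k powr (- r)"])
    (simp add: summable_real_powr_iff)

lemma summable_bounded_mult:
  fixes a w :: "nat \<Rightarrow> real"
  assumes w: "summable w" "\<And>k. w k \<ge> 0" and a: "\<And>k. \<bar>a k\<bar> \<le> Q"
  shows "summable (\<lambda>k. a k * w k)"
  by (rule summable_comparison_test'[of "\<lambda>k. Q * w k" 0])
    (use assms in \<open>auto intro: summable_mult mult_right_mono simp: abs_mult\<close>)

lemma abs_suminf_diff_le_tail:
  fixes a b w :: "nat \<Rightarrow> real"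
  assumes w: "summable w" "\<And>k. w k \<ge> 0"
    and a: "\<And>k. 0 \<le> a k" "\<And>k. a k \<le> Q"
    and b: "\<And>k. 0 \<le> b k" "\<And>k. b k \<le> Q"
    and eq: "\<And>k. k < s \<Longrightarrow> a k = b k"
  shows "\<bar>(\<Sum>k. a k * w k) - (\<Sum>k. b k * w k)\<bar> \<le> Q * (\<Sum>k. w (k + s))"
proof -
  have sa: "summable (\<lambda>k. a k * w k)" and sb: "summable (\<lambda>k. b k * w k)"
    using a b by (auto intro!: summable_bounded_mult[where Q = Q] w)
  define c where "c k = (a k - b k) * w k" for k
  have cb: "\<bar>c k\<bar> \<le> Q * w k" for k
    unfolding c_def abs_mult using a[of k] b[of k] w(2)[of k] by (auto intro!: mult_right_mono)
  have sc: "summable c"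
    unfolding c_def using summable_diff[OF sa sb] by (simp add: algebra_simps)
  have sQ: "summable (\<lambda>k. Q * w (k + s))"
    using w(1) by (intro summable_mult) (simp add: summable_iff_shift)
  have "(\<Sum>k. a k * w k) - (\<Sum>k. b k * w k) = suminf c"
    unfolding c_def by (subst suminf_diff[OF sa sb]) (simp add: algebra_simps)
  also have "\<dots> = (\<Sum>k. c (k + s)) + (\<Sum>k<s. c k)"
    by (rule suminf_split_initial_segment[OF sc])
  also have "(\<Sum>k<s. c k) = 0"
    using eq by (simp add: c_def)
  finally have "\<bar>(\<Sum>k. a k * w k) - (\<Sum>k. b k * w k)\<bar> = norm (\<Sum>k. c (k + s))" by simp
  also have "\<dots> \<le> (\<Sum>k. Q * w (k + s))"
    by (rule norm_suminf_le[OF _ sQ]) (use cb in simp)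
  also have "\<dots> = Q * (\<Sum>k. w (k + s))"
    using w(1) by (intro suminf_mult) (simp add: summable_iff_shift)
  finally show ?thesis .
qed

lemma chi_eq_periodic_load:
  assumes "\<Xi> \<noteq> []" and q: "\<And>x. x \<in> set \<Xi> \<Longrightarrow> q x \<ge> 0" and "r > 1"
  shows "chi q r \<Xi> j = ennreal (periodic_load q r \<Xi> j)"
proof -
  define l where "l = length \<Xi>"
  have l: "l > 0" using assms by (simp add: l_def)
  define a where "a k = q (cyc \<Xi> (j - int k))" for k
  define w where "w k = real (Suc k) powr (- r)" for k
  have a0: "a k \<ge> 0" for k using assms by (simp add: a_def cyc_mem)
  have "\<bar>a k\<bar> \<le> (\<Sum>x\<in>set \<Xi>. q x)" for k
    using assms a0[of k] by (auto simp: a_def cyc_mem intro!: member_le_sum)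
  then have sm: "summable (\<lambda>k. a k * w k)"
    using summable_Suc_powr[OF \<open>r > 1\<close>] unfolding w_def by (intro summable_bounded_mult) auto
  have per: "a (k + n * l) = a k" for k n
  proof (induction n)
    case (Suc n)
    have "a (k + Suc n * l) = a (k + n * l)"
      using cyc_add_length[of \<Xi> "j - int (k + Suc n * l)"] by (simp add: a_def l_def algebra_simps)
    with Suc show ?case by simp
  qed simp
  have "chi q r \<Xi> j = (\<Sum>m<l. ennreal (a m) * (\<Sum>n. ennreal (w (m + n * l))))"
    unfolding chi_def
  proof (rule sum.reindex_bij_witness[where i = "\<lambda>m. j - int m" and j = "\<lambda>i. nat (j - i)"])
    fix i assume i: "i \<in> {j - int (length \<Xi>) + 1..j}"
    have pos: "j + 1 - i + int n * int (length \<Xi>) = int (Suc (nat (j - i) + n * l))" for n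
      using i by (simp add: l_def)
    show "ennreal (a (nat (j - i))) * (\<Sum>n. ennreal (w (nat (j - i) + n * l))) =
       ennreal (q (cyc \<Xi> i)) * (\<Sum>n. ennreal (real_of_int (j + 1 - i + int n * int (length \<Xi>)) powr - r))"
      unfolding pos using i by (simp add: a_def w_def)
  qed (auto simp: l_def)
  also have "\<dots> = (\<Sum>m<l. \<Sum>n. ennreal (a (m + n * l) * w (m + n * l)))"
    using a0 by (simp add: per ennreal_mult' ennreal_suminf_cmult)
  also have "\<dots> = (\<Sum>n. \<Sum>m<l. ennreal (a (m + n * l) * w (m + n * l)))"
    by (rule suminf_sum[symmetric]) simp
  also have "\<dots> = (\<Sum>n. \<Sum>k\<in>{n * l..<n * l + l}. ennreal (a k * w k))"
  proof (intro suminf_cong)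
    fix n show "(\<Sum>m<l. ennreal (a (m + n * l) * w (m + n * l))) = (\<Sum>k\<in>{n * l..<n * l + l}. ennreal (a k * w k))"
      by (rule sum.reindex_bij_witness[where i = "\<lambda>k. k - n * l" and j = "\<lambda>m. m + n * l"]) auto
  qed
  also have "\<dots> = (\<Sum>k. ennreal (a k * w k))"
    using sums_group[OF summable_sums[OF summableI, of "\<lambda>k. ennreal (a k * w k)"] l]
    by (simp add: sums_iff)
  also have "\<dots> = ennreal (\<Sum>k. a k * w k)"
    using a0 sm by (intro suminf_ennreal2) (auto simp: w_def)
  finally show ?thesis by (simp add: periodic_load_def a_def w_def)
qed

lemma change_prob_eq_lag_sum:
  "change_prob \<Psi> q r xs =
     \<Psi> (ennreal (\<Sum>k<length xs. q (xs ! (length xs - Suc k)) * real (Suc k) powr (- r)))"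
proof -
  have "(\<Sum>s=1..length xs. q (xs ! (s - 1)) * real (length xs - s + 1) powr (- r)) =
        (\<Sum>k<length xs. q (xs ! (length xs - Suc k)) * real (Suc k) powr (- r))"
    by (rule sum.reindex_bij_witness[where i = "\<lambda>k. length xs - k" and j = "\<lambda>s. length xs - s"]) auto
  then show ?thesis by (simp add: change_prob_def)
qed

lemma sum_period_int:
  fixes f :: "int \<Rightarrow> real"
  assumes per: "\<And>i. f (i + int l) = f i"
  shows "(\<Sum>i<l. f (j + int i)) = (\<Sum>i=1..int l. f i)"
proof -
  have step: "(\<Sum>i<l. f (j + 1 + int i)) = (\<Sum>i<l. f (j + int i))" for j
  proof -
    have "(\<Sum>i<l. f (j + 1 + int i)) = (\<Sum>i<l. f (j + int (Suc i)))"
      by (simp add: algebra_simps)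
    also have "\<dots> = (\<Sum>i<Suc l. f (j + int i)) - f j"
      by (subst sum.lessThan_Suc_shift) simp
    also have "\<dots> = (\<Sum>i<l. f (j + int i))" using per[of j] by simp
    finally show ?thesis .
  qed
  have "(\<Sum>i<l. f (j + int i)) = (\<Sum>i<l. f (1 + int i))"
    by (induction j rule: int_induct[where k = 1])
      (use step in \<open>simp_all, metis diff_add_cancel\<close>)
  also have "\<dots> = (\<Sum>i=1..int l. f i)"
    by (rule sum.reindex_bij_witness[where i = "\<lambda>i. nat (i - 1)" and j = "\<lambda>i. 1 + int i"]) auto
  finally show ?thesis .
qed

lemma abs_sum_zero_mean_periodic_le:
  fixes f :: "int \<Rightarrow> real"
  assumes per: "\<And>i. f (i + int l) = f i" and zero: "(\<Sum>i=1..int l. f i) = 0"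
    and C: "\<And>i. \<bar>f i\<bar> \<le> C" and "l > 0"
  shows "\<bar>\<Sum>i<n. f (j + int i)\<bar> \<le> real l * C"
proof (induction n arbitrary: j rule: less_induct)
  case (less n)
  have C0: "C \<ge> 0" using C[of 0] by simp
  show ?case
  proof (cases "n < l")
    case True
    have "\<bar>\<Sum>i<n. f (j + int i)\<bar> \<le> (\<Sum>i<n. C)"
      by (rule order.trans[OF sum_abs], rule sum_mono, rule C)
    also have "\<dots> \<le> real l * C" using True C0 by (auto intro: mult_right_mono)
    finally show ?thesis .
  next
    case False
    have "(\<Sum>i<n. f (j + int i)) = (\<Sum>i<l. f (j + int i)) + (\<Sum>i\<in>{l..<n}. f (j + int i))"
      using False by (subst sum.union_disjoint[symmetric]) (auto intro: sum.cong)
    also have "(\<Sum>i\<in>{l..<n}. f (j + int i)) = (\<Sum>i<n - l. f (j + int i))"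
      by (rule sum.reindex_bij_witness[where i = "\<lambda>i. i + l" and j = "\<lambda>i. i - l"])
        (use False per in \<open>auto simp: of_nat_diff algebra_simps\<close>, metis add.commute diff_add_cancel add_diff_eq)
    also have "(\<Sum>i<l. f (j + int i)) = 0"
      using sum_period_int[of f l, OF per] zero by simp
    finally show ?thesis using less[of "n - l" j] False \<open>l > 0\<close> by simp
  qed
qed

lemma average_near_periodic_mean:
  fixes u :: "nat \<Rightarrow> real" and h :: "int \<Rightarrow> real"
  assumes per: "\<And>i. h (i + int l) = h i" and l: "l > 0"
    and u: "\<And>n. \<bar>u n\<bar> \<le> C" and h: "\<And>i. \<bar>h i\<bar> \<le> C"
    and close: "\<And>n. n \<ge> S \<Longrightarrow> \<bar>u n - h (j + int n)\<bar> \<le> e"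
    and M: "M > 0"
  shows "\<bar>1 / real M * (\<Sum>n<M. u n) - 1 / real l * (\<Sum>i=1..int l. h i)\<bar>
           \<le> e + 2 * C * (real S + real l) / real M"
proof -
  define d where "d = 1 / real l * (\<Sum>i=1..int l. h i)"
  have C: "C \<ge> 0" using h[of 0] by simp
  have e: "e \<ge> 0" using close[of S] by simp
  have "\<bar>\<Sum>i=1..int l. h i\<bar> \<le> (\<Sum>i=1..int l. C)"
    by (rule order.trans[OF sum_abs], rule sum_mono, rule h)
  then have d: "\<bar>d\<bar> \<le> C"
    using l by (simp add: d_def abs_mult field_simps)
  have hd: "\<bar>h i - d\<bar> \<le> 2 * C" for i using h[of i] d by linarith
  have "(\<Sum>i=1..int l. h i - d) = 0"
    using l by (simp add: sum_subtractf d_def)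
  then have P: "\<bar>\<Sum>n<M. h (j + int n) - d\<bar> \<le> real l * (2 * C)"
    using abs_sum_zero_mean_periodic_le[of "\<lambda>i. h i - d" l "2 * C" j M] per hd l by simp
  have "\<bar>\<Sum>n<M. u n - h (j + int n)\<bar> \<le> (\<Sum>n<M. \<bar>u n - h (j + int n)\<bar>)"
    by (rule sum_abs)
  also have "\<dots> \<le> (\<Sum>n<M. e + (if n < S then 2 * C else 0))"
  proof (rule sum_mono)
    fix n
    have "\<bar>u n - h (j + int n)\<bar> \<le> 2 * C"
      using u[of n] h[of "j + int n"] by linarith
    then show "\<bar>u n - h (j + int n)\<bar> \<le> e + (if n < S then 2 * C else 0)"
      using close[of n] e by auto
  qed
  also have "\<dots> = real M * e + real (card ({..<M} \<inter> {n. n < S})) * (2 * C)"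
    by (simp add: sum.distrib sum.If_cases)
  also have "card ({..<M} \<inter> {n. n < S}) \<le> card {..<S}"
    by (rule card_mono) auto
  then have "real M * e + real (card ({..<M} \<inter> {n. n < S})) * (2 * C) \<le> real M * e + real S * (2 * C)"
    using C by (auto intro: mult_right_mono)
  finally have U: "\<bar>\<Sum>n<M. u n - h (j + int n)\<bar> \<le> real M * e + real S * (2 * C)" .
  have "(\<Sum>n<M. u n) - real M * d = (\<Sum>n<M. u n - h (j + int n)) + (\<Sum>n<M. h (j + int n) - d)"
    by (simp add: sum_subtractf)
  with U P have "\<bar>(\<Sum>n<M. u n) - real M * d\<bar> \<le> real M * e + 2 * C * (real S + real l)"
    by (simp add: algebra_simps)
  moreover have "1 / real M * (\<Sum>n<M. u n) - d = ((\<Sum>n<M. u n) - real M * d) / real M"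
    using M by (simp add: field_simps)
  ultimately show ?thesis
    using M unfolding d_def[symmetric] by (simp add: field_simps)
qed

lemma continuous_on_omega: "continuous_on {..<1} omega"
  unfolding omega_def by (intro continuous_intros) auto

theorem lemmaG1:
  fixes K l :: nat and \<Psi> :: "ennreal \<Rightarrow> real" and q :: "nat \<Rightarrow> real"
    and r \<epsilon> :: real and \<Xi> :: "nat list"
  assumes "K \<ge> 2"
    and "range \<Psi> \<subseteq> {0..<1}"
    and "continuous_on UNIV \<Psi>"
    and "\<And>x. x \<in> {1..K} \<Longrightarrow> q x \<ge> 0"
    and "r > 1"
    and "l \<ge> 1"
    and "\<Xi> \<in> treatments K l"
    and "\<epsilon> > 0"
  shows "\<exists>M0::nat. M0 > 0 \<and> (\<forall>M\<ge>M0.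
    (SUP t. SUP z\<in>treatments K t. SUP j\<in>{1..int l}.
       ereal \<bar>1 / real M *
                (\<Sum>s=1..M. omega (change_prob \<Psi> q r (z @ segment \<Xi> j (int s + j - 1))))
              - block_rate \<Psi> q r \<Xi>\<bar>) \<le> ereal \<epsilon>)"
proof -
  define w where "w k = real (Suc k) powr (- r)" for k
  define Q where "Q = (\<Sum>x\<in>{1..K}. q x)"
  define B where "B = Q * suminf w"
  define g where "g x = omega (\<Psi> (ennreal x))" for x
  define h where "h p = g (periodic_load q r \<Xi> p)" for p
  have len: "length \<Xi> = l" and set: "set \<Xi> \<subseteq> {1..K}" and ne: "\<Xi> \<noteq> []"
    using assms by (auto simp: treatments_def)
  have w: "summable w" "\<And>k. w k \<ge> 0"
    using summable_Suc_powr[OF \<open>r > 1\<close>] by (simp_all add: w_def[abs_def])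
  have q: "0 \<le> q x" "q x \<le> Q" if "x \<in> {1..K}" for x
    using assms(4) that unfolding Q_def by (auto intro!: member_le_sum)
  have Q0: "Q \<ge> 0" using assms(4) unfolding Q_def by (intro sum_nonneg)
  have series_bounds: "0 \<le> (\<Sum>k. a k * w k) \<and> (\<Sum>k. a k * w k) \<le> B"
    if a: "\<And>k. 0 \<le> a k" "\<And>k. a k \<le> Q" for a
  proof -
    have "summable (\<lambda>k. a k * w k)" using a by (intro summable_bounded_mult[where Q = Q] w) auto
    then have "0 \<le> (\<Sum>k. a k * w k)" using a w by (intro suminf_nonneg) auto
    then show ?thesis
      using abs_suminf_diff_le_tail[of w a Q "\<lambda>_. 0" 0] w a Q0 by (simp add: B_def)
  qed
  have cyc_q: "0 \<le> q (cyc \<Xi> i)" "q (cyc \<Xi> i) \<le> Q" for i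
    using cyc_mem[OF ne, of i] set q by blast+
  have load: "0 \<le> periodic_load q r \<Xi> p \<and> periodic_load q r \<Xi> p \<le> B" for p
    unfolding periodic_load_def w_def[symmetric] by (rule series_bounds) (rule cyc_q)+
  have rate: "block_rate \<Psi> q r \<Xi> = 1 / real l * (\<Sum>i=1..int l. h i)"
  proof -
    have "q x \<ge> 0" if "x \<in> set \<Xi>" for x using that set q by blast
    then show ?thesis
      by (simp add: block_rate_def h_def g_def len chi_eq_periodic_load[OF ne _ \<open>r > 1\<close>])
  qed
  have "continuous_on {0..B} (\<lambda>x. \<Psi> (ennreal x))"
    by (rule continuous_on_compose2[OF assms(3)]) (auto intro!: continuous_on_ennreal continuous_intros)
  then have g: "continuous_on {0..B} g"
    unfolding g_def by (rule continuous_on_compose2[OF continuous_on_omega])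
      (use assms(2) in \<open>auto simp: image_subset_iff\<close>)
  then have "uniformly_continuous_on {0..B} g"
    by (intro compact_uniformly_continuous) auto
  then obtain \<delta> where \<delta>: "\<delta> > 0"
    "\<And>x y. x \<in> {0..B} \<Longrightarrow> y \<in> {0..B} \<Longrightarrow> \<bar>x - y\<bar> < \<delta> \<Longrightarrow> \<bar>g x - g y\<bar> < \<epsilon> / 2"
    unfolding uniformly_continuous_on_def dist_real_def using \<open>\<epsilon> > 0\<close> by (metis half_gt_zero)
  have "bounded (g ` {0..B})"
    using g by (intro compact_imp_bounded compact_continuous_image) auto
  then obtain C where C: "\<And>x. x \<in> {0..B} \<Longrightarrow> \<bar>g x\<bar> \<le> C"
    unfolding bounded_iff by (metis imageI real_norm_def)
  have "(\<lambda>s. Q * (\<Sum>k. w (k + s))) \<longlonglongrightarrow> Q * 0"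
    by (intro tendsto_intros suminf_exist_split2 w)
  then have "eventually (\<lambda>s. Q * (\<Sum>k. w (k + s)) < \<delta>) sequentially"
    using \<delta>(1) by (auto dest: order_tendstoD)
  then obtain S where S: "\<And>s. s \<ge> S \<Longrightarrow> Q * (\<Sum>k. w (k + s)) < \<delta>"
    unfolding eventually_sequentially by blast
  define M0 where "M0 = Suc (nat \<lceil>2 * (2 * C * (real S + real l)) / \<epsilon>\<rceil>)"
  have bound: "\<bar>1 / real M * (\<Sum>s=1..M. omega (change_prob \<Psi> q r (z @ segment \<Xi> j (int s + j - 1))))
              - block_rate \<Psi> q r \<Xi>\<bar> \<le> \<epsilon>"
    if M: "M \<ge> M0" and z: "z \<in> treatments K t" for M t z j
  proof -
    define v where "v s = z @ segment \<Xi> j (int s + j - 1)" for s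
    define a where "a s k = (if k < length (v s) then q (v s ! (length (v s) - Suc k)) else 0)" for s k
    define u where "u n = g (\<Sum>k. a (Suc n) k * w k)" for n
    have "set (segment \<Xi> j i) \<subseteq> {1..K}" for i
      using cyc_mem[OF ne] set by (auto simp: segment_def)
    then have "set (v s) \<subseteq> {1..K}" for s
      using z by (auto simp: v_def treatments_def)
    then have mem: "v s ! (length (v s) - Suc k) \<in> {1..K}" if "k < length (v s)" for s k
      using that by (metis diff_less length_greater_0_conv list.size(3) not_less_zero nth_mem subsetD zero_less_Suc)
    have a: "0 \<le> a s k" "a s k \<le> Q" for s k
      using q[OF mem] Q0 by (auto simp: a_def)
    have "(\<Sum>k. a s k * w k) = (\<Sum>k<length (v s). a s k * w k)" for s
      by (rule suminf_finite) (auto simp: a_def)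
    then have cp: "omega (change_prob \<Psi> q r (v s)) = g (\<Sum>k. a s k * w k)" for s
      by (simp add: change_prob_eq_lag_sum g_def a_def w_def)
    have sum_u: "(\<Sum>s=1..M. omega (change_prob \<Psi> q r (v s))) = (\<Sum>n<M. u n)"
      unfolding cp u_def by (rule sum.reindex_bij_witness[where i = Suc and j = "\<lambda>s. s - 1"]) auto
    have in_range: "(\<Sum>k. a s k * w k) \<in> {0..B}" for s
      using series_bounds[of "a s", OF a] by simp
    have close: "\<bar>u n - h (j + int n)\<bar> \<le> \<epsilon> / 2" if "n \<ge> S" for n
    proof -
      have "a (Suc n) k = q (cyc \<Xi> (j + int n - int k))" if "k < Suc n" for k
        using nth_append_segment_from_end[OF that, of z \<Xi> j] that length_segment[of \<Xi> j "Suc n"]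
        by (simp add: a_def v_def)
      then have "\<bar>(\<Sum>k. a (Suc n) k * w k) - periodic_load q r \<Xi> (j + int n)\<bar>
                   \<le> Q * (\<Sum>k. w (k + Suc n))"
        unfolding periodic_load_def w_def[symmetric]
        by (intro abs_suminf_diff_le_tail w a cyc_q) auto
      also have "\<dots> < \<delta>" using S[of "Suc n"] that by simp
      finally show ?thesis
        using \<delta>(2)[OF in_range, of "periodic_load q r \<Xi> (j + int n)"] load
        unfolding u_def h_def by fastforce
    qed
    have "M > 0" using M by (simp add: M0_def)
    have "h (i + int l) = h i" for i
      using periodic_load_add_length[of q r \<Xi> i] by (simp add: h_def len)
    then have "\<bar>1 / real M * (\<Sum>n<M. u n) - 1 / real l * (\<Sum>i=1..int l. h i)\<bar>
           \<le> \<epsilon> / 2 + 2 * C * (real S + real l) / real M"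
      using load in_range \<open>l \<ge> 1\<close> \<open>M > 0\<close> close
      by (intro average_near_periodic_mean[where j = j]) (auto simp: u_def h_def intro!: C)
    also have "2 * C * (real S + real l) / real M \<le> \<epsilon> / 2"
    proof -
      have "2 * (2 * C * (real S + real l)) / \<epsilon> \<le> real M"
        using M unfolding M0_def by linarith
      then show ?thesis using \<open>\<epsilon> > 0\<close> \<open>M > 0\<close> by (simp add: field_simps)
    qed
    finally show ?thesis unfolding rate sum_u[unfolded v_def] by simp
  qed
  have "M0 > 0" by (simp add: M0_def)
  with bound show ?thesis
    by (intro exI[of _ M0]) (auto intro!: SUP_least)
qed

end
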